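(* Let $k\geq l\geq 1$. Then $$F_{U_l^k}(x)=R_{k-l;E(x)}(x),$$ where $E(x)=\sum_{j=0}^{l-1} c_jx^j$ and $c_j$ is the $j$th Catalan number.
   Context: $S_n$ is the set of permutations of $\{1,\dots,n\}$ written as words ($S_0$ consists of the empty permutation). A permutation $\rho\in S_n$ contains a pattern $\tau\in S_k$ if some subsequence of $\rho$ of length $k$ is order-isomorphic to $\tau$; otherwise it avoids $\tau$. For a set $T$ of patterns, $F_T(x)=\sum_{n\ge0} a_n x^n$, where $a_n$ is the number of $\rho\in S_n$ that avoid $132$ and avoid every pattern in $T$. For $k\ge l\ge 1$, $U_l^k$ is the set of all permutations $\tau\in S_k$ such that $(\tau_{l+1},\tau_{l+2},\dots,\tau_k)=(l+1,l+2,\dots,k)$ (so $|U_l^k|=l!$). $R_{k;E}(x)$ denotes the continued fraction with $k$ steps: $R_{0;E}(x)=E$ and $R_{k;E}(x)=\frac{1}{1-xR_{k-1;E}(x)}$ for $k\ge1$. The Catalan numbers are $c_j=\frac{1}{j+1}\binom{2j}{j}$. *)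

theory Defs
  imports
    "HOL-Library.Sublist"
    "HOL-Combinatorics.Multiset_Permutations"
    "HOL-Computational_Algebra.Formal_Power_Series"
begin

(* Permutations of {1..n} are words, i.e. elements of permutations_of_set {1..n} :: nat list set.
   Words carry 1-based letters but list positions are 0-based. *)
abbreviation perms :: "nat \<Rightarrow> nat list set" where
  "perms n \<equiv> permutations_of_set {1..n}"

definition order_isomorphic :: "nat list \<Rightarrow> nat list \<Rightarrow> bool" where
  "order_isomorphic xs ys \<longleftrightarrow> length xs = length ys \<and>
     (\<forall>i<length xs. \<forall>j<length xs. xs ! i < xs ! j \<longleftrightarrow> ys ! i < ys ! j)"

definition contains_pattern :: "nat list \<Rightarrow> nat list \<Rightarrow> bool" where
  "contains_pattern \<rho> \<tau> \<longleftrightarrow> (\<exists>\<sigma>. subseq \<sigma> \<rho> \<and> order_isomorphic \<sigma> \<tau>)"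

abbreviation avoids :: "nat list \<Rightarrow> nat list \<Rightarrow> bool" where
  "avoids \<rho> \<tau> \<equiv> \<not> contains_pattern \<rho> \<tau>"

definition avoiders_gf :: "nat list set \<Rightarrow> rat fps" where
  "avoiders_gf T =
     Abs_fps (\<lambda>n. of_nat (card {\<rho> \<in> perms n. avoids \<rho> [1, 3, 2] \<and> (\<forall>\<tau>\<in>T. avoids \<rho> \<tau>)}))"

definition U_patterns :: "nat \<Rightarrow> nat \<Rightarrow> nat list set" where
  "U_patterns l k = {\<tau> \<in> perms k. drop l \<tau> = [l + 1..<k + 1]}"

(* 1 - X * R always has constant term 1, so the division is by a unit of the power series ring. *)
primrec cont_frac :: "nat \<Rightarrow> rat fps \<Rightarrow> rat fps" where
  "cont_frac 0 E = E"
| "cont_frac (Suc k) E = 1 / (1 - fps_X * cont_frac k E)"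

definition catalan :: "nat \<Rightarrow> rat" where
  "catalan j = 1 / of_nat (j + 1) * of_nat ((2 * j) choose j)"

end

theory Submission imports Defs begin

unbundle fps_syntax

text \<open>
  A 132-avoiding permutation of \<open>{1..n + 1}\<close> has the form \<open>\<alpha> (n + 1) \<beta>\<close> where every letter of
  \<open>\<alpha>\<close> exceeds every letter of \<open>\<beta>\<close> and both parts avoid 132. For \<open>k > l\<close> the last letter of a
  pattern in \<open>U\<^sub>l\<^sup>k\<close> is its maximum, so an occurrence either lies in \<open>\<beta>\<close> or, after deleting
  its last letter, becomes an occurrence of a pattern of \<open>U\<^sub>l\<^sup>k\<^sup>-\<^sup>1\<close> in \<open>\<alpha>\<close>. Hence
  \<open>F\<^sub>k = 1 + x F\<^sub>k\<^sub>-\<^sub>1 F\<^sub>k\<close>. In the base case \<open>k = l\<close> the set of patterns is all of \<open>S\<^sub>l\<close>, which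
  leaves the 132-avoiding permutations of length less than \<open>l\<close>.
\<close>

section \<open>Pattern containment\<close>

lemma set_mono_subseq: "subseq xs ys \<Longrightarrow> set xs \<subseteq> set ys"
  by (auto elim: list_emb_set)

text \<open>A strictly increasing map preserves every comparison. Needed because the left part of
  the decomposition at the maximum appears shifted by \<open>j\<close>.\<close>

lemma contains_pattern_map_iff:
  assumes "strict_mono f"
  shows "contains_pattern (map f xs) \<tau> \<longleftrightarrow> contains_pattern xs \<tau>"
proof -
  have iso: "order_isomorphic (map f \<sigma>) \<tau> \<longleftrightarrow> order_isomorphic \<sigma> \<tau>" for \<sigma>
    using strict_mono_less[OF assms] by (auto simp: order_isomorphic_def)
  show ?thesis
    unfolding contains_pattern_def subseq_conv_nths nths_map
    by (metis iso)
qed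

lemma contains_132_iff:
  "contains_pattern xs [1, 3, 2] \<longleftrightarrow> (\<exists>a b c. subseq [a, b, c] xs \<and> a < c \<and> c < b)"
proof
  assume "contains_pattern xs [1, 3, 2]"
  then obtain \<sigma> where \<sigma>: "subseq \<sigma> xs" "order_isomorphic \<sigma> [1, 3, 2]"
    by (auto simp: contains_pattern_def)
  then obtain a b c where abc: "\<sigma> = [a, b, c]"
    by (auto simp: order_isomorphic_def length_Suc_conv numeral_eq_Suc)
  have "a < c" "c < b"
    using \<sigma>(2) unfolding abc order_isomorphic_def
    by (force dest: spec[of _ 0] spec[of _ 2], force dest: spec[of _ 2] spec[of _ 1])
  with \<sigma> abc show "\<exists>a b c. subseq [a, b, c] xs \<and> a < c \<and> c < b" by blast
next
  assume "\<exists>a b c. subseq [a, b, c] xs \<and> a < c \<and> c < b"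
  then obtain a b c where abc: "subseq [a, b, c] xs" "a < c" "c < b" by blast
  then have "order_isomorphic [a, b, c] [1, 3, 2]"
    by (auto simp: order_isomorphic_def less_Suc_eq numeral_eq_Suc)
  with abc show "contains_pattern xs [1, 3, 2]"
    by (auto simp: contains_pattern_def)
qed

text \<open>The maximum \<open>M\<close> can only play the 3. An occurrence therefore lies inside
  one part, or takes its 1 from \<alpha> and its 2 from \<beta>; for such a pair \<open>M\<close>
  itself serves as the 3.\<close>

lemma avoids_132_append_Cons_iff:
  assumes "\<And>x. x \<in> set \<alpha> \<union> set \<beta> \<Longrightarrow> x < M"
  shows "avoids (\<alpha> @ M # \<beta>) [1, 3, 2] \<longleftrightarrow>
    avoids \<alpha> [1, 3, 2] \<and> avoids \<beta> [1, 3, 2] \<and> (\<forall>a\<in>set \<alpha>. \<forall>c\<in>set \<beta>. c \<le> a)"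
proof -
  have "contains_pattern (\<alpha> @ M # \<beta>) [1, 3, 2]" if "contains_pattern \<alpha> [1, 3, 2]"
    using that unfolding contains_pattern_def by (meson subseq_order.trans list_emb_append2 subseq_rev_drop_many)
  moreover have "contains_pattern (\<alpha> @ M # \<beta>) [1, 3, 2]" if "contains_pattern \<beta> [1, 3, 2]"
    using that unfolding contains_pattern_def by (meson subseq_order.trans subseq_drop_many list_emb_Cons)
  moreover have "contains_pattern (\<alpha> @ M # \<beta>) [1, 3, 2]"
    if "a \<in> set \<alpha>" "c \<in> set \<beta>" "a < c" for a c
  proof -
    have "subseq [a] \<alpha>" "subseq [c] \<beta>"
      using that by (simp_all add: subseq_singleton_left)
    then have "subseq ([a] @ M # [c]) (\<alpha> @ M # \<beta>)"
      by (intro list_emb_append_mono) auto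
    with that assms show ?thesis
      unfolding contains_132_iff by auto
  qed
  moreover have "contains_pattern \<alpha> [1, 3, 2] \<or> contains_pattern \<beta> [1, 3, 2] \<or>
      (\<exists>a\<in>set \<alpha>. \<exists>c\<in>set \<beta>. a < c)"
    if cont: "contains_pattern (\<alpha> @ M # \<beta>) [1, 3, 2]"
  proof -
    obtain a b c where abc: "subseq [a, b, c] (\<alpha> @ M # \<beta>)" "a < c" "c < b"
      using cont unfolding contains_132_iff by blast
    then obtain s t where st: "[a, b, c] = s @ t" "subseq s \<alpha>" "subseq t (M # \<beta>)"
      by (auto elim: subseq_appendE)
    show ?thesis
    proof (cases "t = []")
      case True
      then have "subseq [a, b, c] \<alpha>" using st by simp
      then show ?thesis using abc(2,3) unfolding contains_132_iff by blast
    next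
      case False
      then have c: "c = last t" "c \<in> set t"
        using st(1) by (metis last.simps last_appendR list.distinct(1), metis last_appendR last.simps last_in_set list.distinct(1))
      have sub: "x \<in> set t \<Longrightarrow> x = M \<or> x \<in> set \<beta>" "x \<in> set s \<Longrightarrow> x \<in> set \<alpha>" for x
        using st(2,3) by (auto dest!: set_mono_subseq)
      have "b \<in> set \<alpha> \<union> set \<beta> \<union> {M}"
        using st(1) sub by (metis UnCI Un_iff insertI1 insert_iff list.set_intros set_append)
      \<comment> \<open>The letter \<open>b\<close> is at most \<open>M\<close>, so \<open>c\<close>
        lies strictly below \<open>M\<close>.\<close>
      then have "c \<noteq> M" using abc(3) assms by fastforce
      then have c\<beta>: "c \<in> set \<beta>" using sub c by auto
      show ?thesis
      proof (cases s)
        case Nil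
        then have t: "t = [a, b, c]" using st by simp
        have "a \<noteq> M" using abc c\<beta> assms by fastforce
        then have "subseq [a, b, c] \<beta>" using st t by (auto split: if_splits)
        then show ?thesis using abc(2,3) unfolding contains_132_iff by blast
      next
        case (Cons y ys)
        then have "a \<in> set \<alpha>" using st sub by simp
        then show ?thesis using c\<beta> abc by blast
      qed
    qed
  qed
  ultimately show ?thesis by (meson linorder_not_le)
qed

section \<open>Decomposition of 132-avoiding permutations at the maximum\<close>

text \<open>An arbitrary predicate lets one counting argument serve both the unrestricted and the
  \<open>U_free\<close> classes.\<close>

definition avoiders :: "(nat list \<Rightarrow> bool) \<Rightarrow> nat \<Rightarrow> nat list set" where
  "avoiders P n = {\<rho> \<in> perms n. avoids \<rho> [1, 3, 2] \<and> P \<rho>}"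

lemma finite_avoiders [simp]: "finite (avoiders P n)"
  by (simp add: avoiders_def)

lemma avoiders_0: "avoiders P 0 = (if P [] then {[]} else {})"
  unfolding avoiders_def contains_132_iff by auto

lemma downward_closed_eq_atLeastAtMost:
  assumes "B \<subseteq> {1..n}" and "\<And>x y. y \<in> B \<Longrightarrow> 1 \<le> x \<Longrightarrow> x \<le> y \<Longrightarrow> x \<in> B"
  shows "\<exists>j\<le>n. B = {1..j::nat}"
proof (cases "B = {}")
  case True
  then show ?thesis by (intro exI[of _ 0]) auto
next
  case False
  have fin: "finite B" using assms(1) finite_subset by blast
  have "B = {1..Max B}"
  proof (intro equalityI subsetI)
    fix x assume "x \<in> B"
    then show "x \<in> {1..Max B}" using assms(1) Max_ge[OF fin] by auto
  next
    fix x assume "x \<in> {1..Max B}"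
    then show "x \<in> B" using assms(2)[OF Max_in[OF fin False]] by simp
  qed
  moreover have "Max B \<le> n" using assms(1) Max_in[OF fin False] by auto
  ultimately show ?thesis by blast
qed

text \<open>The letters of \<beta> lie below those of \<alpha>, so they fill an initial segment
  \<open>{1..j}\<close>, and \<alpha> is a permutation shifted by \<open>j\<close>.\<close>

lemma perms_132_decompose:
  assumes \<rho>: "\<rho> \<in> perms (Suc n)" and av: "avoids \<rho> [1, 3, 2]"
  shows "\<exists>j\<le>n. \<exists>\<alpha>\<in>perms (n - j). \<exists>\<beta>\<in>perms j. \<rho> = map ((+) j) \<alpha> @ Suc n # \<beta>"
proof -
  have set\<rho>: "set \<rho> = {1..Suc n}" and dist: "distinct \<rho>"
    using \<rho> by (auto dest: permutations_of_setD)
  have "Suc n \<in> set \<rho>" using set\<rho> by simp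
  then obtain \<alpha> \<beta> where \<rho>_eq: "\<rho> = \<alpha> @ Suc n # \<beta>"
    by (blast dest: split_list)
  have disj: "set \<alpha> \<inter> set \<beta> = {}" "Suc n \<notin> set \<alpha> \<union> set \<beta>" "distinct \<alpha>" "distinct \<beta>"
    using dist by (auto simp: \<rho>_eq)
  have un: "set \<alpha> \<union> set \<beta> = {1..n}"
  proof -
    have "set \<alpha> \<union> set \<beta> = set \<rho> - {Suc n}" using disj(2) unfolding \<rho>_eq by simp
    also have "\<dots> = {1..n}" unfolding set\<rho> by auto
    finally show ?thesis .
  qed
  have le: "c \<le> a" if "a \<in> set \<alpha>" "c \<in> set \<beta>" for a c
  proof -
    have "x < Suc n" if "x \<in> set \<alpha> \<union> set \<beta>" for x
      using that unfolding un by simp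
    from avoids_132_append_Cons_iff[OF this] show ?thesis
      using av that unfolding \<rho>_eq by blast
  qed
  \<comment> \<open>Downward closure: a missing \<open>x\<close> would lie in \<alpha>, hence be at
    least \<open>y\<close>, forcing \<open>x = y\<close>.\<close>
  have "x \<in> set \<beta>" if "y \<in> set \<beta>" "1 \<le> x" "x \<le> y" for x y
  proof (rule ccontr)
    assume "x \<notin> set \<beta>"
    have "y \<in> {1..n}" using that(1) unfolding un[symmetric] by simp
    then have "x \<in> set \<alpha> \<union> set \<beta>" using that(2,3) unfolding un by simp
    then have "x \<in> set \<alpha>" using \<open>x \<notin> set \<beta>\<close> by simp
    then have "x = y" using le[OF _ that(1)] that(3) by (intro antisym)
    then show False using that(1) \<open>x \<notin> set \<beta>\<close> by simp
  qed
  then obtain j where j: "j \<le> n" "set \<beta> = {1..j}"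
    using downward_closed_eq_atLeastAtMost[of "set \<beta>" n] un by blast
  have set\<alpha>: "set \<alpha> = {Suc j..n}"
  proof -
    have "set \<alpha> = (set \<alpha> \<union> set \<beta>) - set \<beta>" using disj(1) by blast
    also have "\<dots> = {1..n} - {1..j}" using un j(2) by simp
    also have "\<dots> = {Suc j..n}" by auto
    finally show ?thesis .
  qed
  \<comment> \<open>All letters of \<alpha> exceed \<open>j\<close>, so the truncated subtraction is
    exact.\<close>
  define \<alpha>' where "\<alpha>' = map (\<lambda>x. x - j) \<alpha>"
  have "map ((+) j) \<alpha>' = \<alpha>"
    using set\<alpha> by (auto simp: \<alpha>'_def intro!: map_idI)
  moreover have "\<alpha>' \<in> perms (n - j)"
  proof (rule permutations_of_setI)
    show "distinct \<alpha>'"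
      using disj(3) \<open>map ((+) j) \<alpha>' = \<alpha>\<close> by (auto simp: distinct_map)
    have "(+) j ` set \<alpha>' = set \<alpha>"
      using \<open>map ((+) j) \<alpha>' = \<alpha>\<close> by (metis image_set)
    also have "\<dots> = (+) j ` {1..n - j}"
      using j(1) set\<alpha> by simp
    finally show "set \<alpha>' = {1..n - j}"
      unfolding inj_image_eq_iff[OF inj_on_add] .
  qed
  moreover have "\<beta> \<in> perms j" using j disj by (auto intro: permutations_of_setI)
  moreover have "\<rho> = map ((+) j) \<alpha>' @ Suc n # \<beta>"
    using \<rho>_eq \<open>map ((+) j) \<alpha>' = \<alpha>\<close> by simp
  ultimately show ?thesis
    using j(1) by (intro exI[of _ j] conjI bexI[of _ \<alpha>'] bexI[of _ \<beta>])
qed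

lemma glue_perms:
  assumes "j \<le> n" "\<alpha> \<in> perms (n - j)" "\<beta> \<in> perms j"
  shows "map ((+) j) \<alpha> @ Suc n # \<beta> \<in> perms (Suc n)"
proof -
  have a: "set \<alpha> = {1..n - j}" "distinct \<alpha>" and b: "set \<beta> = {1..j}" "distinct \<beta>"
    using assms by (auto dest: permutations_of_setD)
  have "set (map ((+) j) \<alpha>) = {Suc j..n}"
    using assms(1) a by (simp add: add.commute)
  with a b assms(1) show ?thesis
    by (intro permutations_of_setI) (auto simp: distinct_map)
qed

lemma glue_avoids_132_iff:
  assumes "j \<le> n" "\<alpha> \<in> perms (n - j)" "\<beta> \<in> perms j"
  shows "avoids (map ((+) j) \<alpha> @ Suc n # \<beta>) [1, 3, 2] \<longleftrightarrow>
    avoids \<alpha> [1, 3, 2] \<and> avoids \<beta> [1, 3, 2]"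
proof -
  have "set \<alpha> = {1..n - j}" "set \<beta> = {1..j}"
    using assms by (auto dest: permutations_of_setD)
  moreover have "strict_mono ((+) j)" by (simp add: strict_mono_def)
  ultimately show ?thesis
    using assms(1)
    by (subst avoids_132_append_Cons_iff) (auto simp: contains_pattern_map_iff)
qed

text \<open>Gluing the shifted left part, the maximum and the right part is a bijection onto the
  132-avoiders of length \<open>Suc n\<close>, and it respects the predicates by
  \<open>split\<close>.\<close>

lemma card_avoiders_Suc:
  assumes split: "\<And>j \<alpha> \<beta>. j \<le> n \<Longrightarrow> \<alpha> \<in> perms (n - j) \<Longrightarrow> \<beta> \<in> perms j \<Longrightarrow>
    R (map ((+) j) \<alpha> @ Suc n # \<beta>) \<longleftrightarrow> P \<alpha> \<and> Q \<beta>"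
  shows "card (avoiders R (Suc n)) = (\<Sum>j\<le>n. card (avoiders Q j) * card (avoiders P (n - j)))"
proof -
  let ?S = "SIGMA j:{..n}. avoiders Q j \<times> avoiders P (n - j)"
  let ?g = "\<lambda>(j, \<beta>, \<alpha>). map ((+) j) \<alpha> @ Suc n # \<beta>"
  have "avoiders R (Suc n) = ?g ` ?S"
  proof (intro equalityI subsetI)
    fix \<rho> assume "\<rho> \<in> avoiders R (Suc n)"
    then have \<rho>: "\<rho> \<in> perms (Suc n)" "avoids \<rho> [1, 3, 2]" "R \<rho>"
      by (auto simp: avoiders_def)
    from perms_132_decompose[OF \<rho>(1,2)] obtain j \<alpha> \<beta> where d:
      "j \<le> n" "\<alpha> \<in> perms (n - j)" "\<beta> \<in> perms j" "\<rho> = map ((+) j) \<alpha> @ Suc n # \<beta>"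
      by blast
    with \<rho> have "(j, \<beta>, \<alpha>) \<in> ?S"
      using split[OF d(1-3)] glue_avoids_132_iff[OF d(1-3)] by (simp add: avoiders_def)
    then show "\<rho> \<in> ?g ` ?S" using d(4) by (force simp: image_iff)
  next
    fix \<rho> assume "\<rho> \<in> ?g ` ?S"
    then obtain j \<alpha> \<beta> where "j \<le> n" "\<beta> \<in> avoiders Q j" "\<alpha> \<in> avoiders P (n - j)"
      "\<rho> = map ((+) j) \<alpha> @ Suc n # \<beta>" by auto
    then show "\<rho> \<in> avoiders R (Suc n)"
      using split glue_avoids_132_iff glue_perms by (simp add: avoiders_def)
  qed
  moreover have "inj_on ?g ?S"
  proof (rule inj_onI)
    fix p q assume pq: "p \<in> ?S" "q \<in> ?S" "?g p = ?g q"
    obtain j \<beta> \<alpha> j' \<beta>' \<alpha>' where p: "p = (j, \<beta>, \<alpha>)" and q: "q = (j', \<beta>', \<alpha>')"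
      by (metis prod_cases3)
    have h: "j \<le> n" "\<beta> \<in> avoiders Q j" "\<alpha> \<in> avoiders P (n - j)"
      "j' \<le> n" "\<beta>' \<in> avoiders Q j'" "\<alpha>' \<in> avoiders P (n - j')"
      and eq: "map ((+) j) \<alpha> @ Suc n # \<beta> = map ((+) j') \<alpha>' @ Suc n # \<beta>'"
      using pq by (simp_all add: p q)
    have len: "length \<beta> = j" "length \<beta>' = j'"
      using h by (auto simp: avoiders_def length_finite_permutations_of_set)
    have "set \<alpha> = {1..n - j}" "set \<beta> = {1..j}"
      using h by (auto simp: avoiders_def dest: permutations_of_setD)
    \<comment> \<open>The maximum occurs only once, so its position determines both parts; the
      length of \<beta> then recovers \<open>j\<close>.\<close>
    then have "Suc n \<notin> set (map ((+) j) \<alpha>)" "Suc n \<notin> set \<beta>"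
      using h(1) by auto
    then have e: "map ((+) j) \<alpha> = map ((+) j') \<alpha>'" "\<beta> = \<beta>'"
      using eq by (simp_all add: append_Cons_eq_iff)
    with len have "j = j'" by simp
    with e show "p = q"
      by (simp add: p q inj_map_eq_map)
  qed
  ultimately have "card (avoiders R (Suc n)) = card ?S"
    by (simp add: card_image)
  also have "\<dots> = (\<Sum>j\<le>n. card (avoiders Q j) * card (avoiders P (n - j)))"
    by (subst card_SigmaI) (auto simp: card_cartesian_product)
  finally show ?thesis .
qed

section \<open>Generating functions of classes of 132-avoiders\<close>

definition gf :: "(nat list \<Rightarrow> bool) \<Rightarrow> rat fps" where
  "gf P = Abs_fps (\<lambda>n. of_nat (card (avoiders P n)))"

text \<open>The sum over \<open>j\<close> is a Cauchy product, \<open>fps_X\<close> accounts for the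
  maximum and 1 for the empty word. The left part may obey a condition \<open>P\<close> different
  from that on the whole word.\<close>

lemma gf_recurrence:
  assumes "R []"
    and "\<And>n j \<alpha> \<beta>. j \<le> n \<Longrightarrow> \<alpha> \<in> perms (n - j) \<Longrightarrow> \<beta> \<in> perms j \<Longrightarrow>
      R (map ((+) j) \<alpha> @ Suc n # \<beta>) \<longleftrightarrow> P \<alpha> \<and> Q \<beta>"
  shows "gf R = 1 + fps_X * (gf Q * gf P)"
proof (rule fps_ext)
  fix n
  show "gf R $ n = (1 + fps_X * (gf Q * gf P)) $ n"
  proof (cases n)
    case 0
    then show ?thesis using assms(1) by (simp add: gf_def avoiders_0)
  next
    case (Suc m)
    have "card (avoiders R (Suc m)) = (\<Sum>j\<le>m. card (avoiders Q j) * card (avoiders P (m - j)))"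
      by (rule card_avoiders_Suc) (use assms(2) in blast)
    then have "gf R $ Suc m = (gf Q * gf P) $ m"
      by (simp add: gf_def fps_mult_nth atLeast0AtMost)
    then show ?thesis by (simp add: Suc)
  qed
qed

section \<open>Catalan numbers\<close>

text \<open>
  The series \<open>y = 1 - 2 x C\<close> satisfies \<open>y\<^sup>2 = 1 - 4 x\<close>, hence the differential equation
  \<open>(1 - 4 x) y' = - 2 y\<close>, which is a two-term recurrence for the coefficients.
\<close>

lemma catalan_recurrence:
  fixes C :: "rat fps"
  assumes C: "C = 1 + fps_X * (C * C)"
  shows "of_nat (n + 2) * C $ Suc n = (4 * of_nat n + 2) * C $ n"
proof -
  define y where "y = 1 - 2 * fps_X * C"
  have "y * y = 1 - 4 * fps_X * (C - fps_X * (C * C))"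
    by (simp add: y_def algebra_simps)
  also have "C - fps_X * (C * C) = 1" using C by (simp add: algebra_simps)
  finally have yy: "y * y = 1 - 4 * fps_X" by simp
  have "fps_deriv (y * y) = -4"
    unfolding yy by simp
  then have "2 * (y * fps_deriv y) = 2 * (-2)" by (simp add: algebra_simps)
  then have y_deriv: "y * fps_deriv y = -2" by (subst (asm) mult_cancel_left) simp
  \<comment> \<open>One more factor \<open>y\<close> allows \<open>y * y\<close> to be replaced by
    \<open>1 - 4 * fps_X\<close>, without dividing by \<open>y\<close>.\<close>
  have "y * y * fps_deriv y = y * (y * fps_deriv y)" by (rule mult.assoc)
  also have "\<dots> = -2 * y" unfolding y_deriv by (rule mult.commute)
  finally have "y * y * fps_deriv y = -2 * y" .
  then have ode: "fps_deriv y - 4 * (fps_X * fps_deriv y) = -2 * y"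
    unfolding yy by (simp add: algebra_simps)
  have y_Suc: "y $ Suc m = -2 * C $ m" for m
    by (simp add: y_def mult.assoc numeral_fps_const)
  \<comment> \<open>Up to the factor -2, this says
    \<open>(n + 2) * C $ Suc n - 4 * (n + 1) * C $ n = -2 * C $ n\<close>.\<close>
  have "(fps_deriv y - 4 * (fps_X * fps_deriv y)) $ Suc n = (-2 * y) $ Suc n"
    by (simp only: ode)
  then show ?thesis
    by (simp add: y_Suc numeral_fps_const algebra_simps fps_const_neg[symmetric] del: fps_const_neg)
qed

text \<open>One central binomial coefficient is linked to the next through
  \<open>(2 * n + 1) choose n\<close>, by absorption twice and the symmetry of that row.\<close>

lemma catalan_Suc: "of_nat (n + 2) * catalan (Suc n) = (4 * of_nat n + 2) * catalan n"
proof -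
  have "Suc n * ((2 * n + 2) choose Suc n) = 2 * (2 * n + 1) * ((2 * n) choose n)"
  proof -
    have 1: "Suc n * ((2 * n + 2) choose Suc n) = (2 * n + 2) * ((2 * n + 1) choose n)"
      using Suc_times_binomial_eq[of "2 * n + 1" n] by (simp add: algebra_simps)
    have "Suc n * ((2 * n + 1) choose n) = Suc n * ((2 * n + 1) choose Suc n)"
      using binomial_symmetric[of n "2 * n + 1"] by simp
    also have "\<dots> = (2 * n + 1) * ((2 * n) choose n)"
      using Suc_times_binomial_eq[of "2 * n" n] by (simp add: algebra_simps)
    finally show ?thesis using 1 by (simp add: algebra_simps)
  qed
  then have "of_nat (Suc n * ((2 * n + 2) choose Suc n)) =
      (of_nat (2 * (2 * n + 1) * ((2 * n) choose n)) :: rat)"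
    by (simp only:)
  then show ?thesis
    by (simp add: catalan_def field_simps del: binomial_Suc_Suc)
qed

text \<open>The counting series satisfies \<open>C = 1 + fps_X * (C * C)\<close>, so its
  coefficients obey the same first-order recurrence as the closed form; both start at 1.\<close>

lemma card_132_avoiders: "of_nat (card (avoiders (\<lambda>_. True) n)) = catalan n"
proof -
  define C where "C = gf (\<lambda>_. True)"
  have rec: "C = 1 + fps_X * (C * C)"
    unfolding C_def by (rule gf_recurrence) simp_all
  have "C $ n = catalan n"
  proof (induction n)
    case 0
    show ?case by (simp add: C_def gf_def avoiders_0 catalan_def)
  next
    case (Suc n)
    have "of_nat (n + 2) * C $ Suc n = of_nat (n + 2) * catalan (Suc n)"
      by (simp only: catalan_recurrence[OF rec] catalan_Suc Suc)
    then show ?case by (simp del: of_nat_add)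
  qed
  then show ?thesis by (simp add: C_def gf_def)
qed

section \<open>Occurrences of the patterns of \<open>U\<^sub>l\<^sup>k\<close>\<close>

text \<open>An intrinsic description of the occurrences of \<open>U_patterns\<close> in words with
  distinct letters: only comparisons remain of the fixed tail. Index \<open>l\<close> is position l
  + 1 in 1-based counting.\<close>

definition U_shape :: "nat \<Rightarrow> nat list \<Rightarrow> bool" where
  "U_shape l \<sigma> \<longleftrightarrow> (\<forall>j<length \<sigma>. l \<le> j \<longrightarrow> (\<forall>i<j. \<sigma> ! i < \<sigma> ! j))"

lemma U_shape_snoc:
  "U_shape l (\<sigma> @ [z]) \<longleftrightarrow> U_shape l \<sigma> \<and> (l \<le> length \<sigma> \<longrightarrow> (\<forall>y\<in>set \<sigma>. y < z))"
  by (auto simp: U_shape_def nth_append less_Suc_eq all_set_conv_all_nth)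

lemma U_shape_order_isomorphic:
  assumes "order_isomorphic \<sigma> \<tau>" "U_shape l \<tau>"
  shows "U_shape l \<sigma>"
  using assms unfolding order_isomorphic_def U_shape_def by (metis order.strict_trans)

text \<open>The pattern has \<open>j + 1\<close> at each index \<open>j\<close> from
  \<open>l\<close> on. A value v of at least \<open>j + 1\<close> before index \<open>j\<close>
  would occur a second time at index v - 1, against distinctness.\<close>

lemma U_shape_U_patterns:
  assumes "\<tau> \<in> U_patterns l k"
  shows "U_shape l \<tau>"
  unfolding U_shape_def
proof (intro allI impI)
  fix i j assume j: "j < length \<tau>" "l \<le> j" and i: "i < j"
  have perm: "set \<tau> = {1..k}" "distinct \<tau>" "length \<tau> = k" and drop: "drop l \<tau> = [l + 1..<k + 1]"
    using assms by (auto simp: U_patterns_def dest: permutations_of_setD length_finite_permutations_of_set)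
  have upper: "\<tau> ! m = Suc m" if "l \<le> m" "m < k" for m
  proof -
    have "\<tau> ! m = drop l \<tau> ! (m - l)" using that perm by simp
    also have "\<dots> = Suc m" unfolding drop using that by (subst nth_upt) auto
    finally show ?thesis .
  qed
  show "\<tau> ! i < \<tau> ! j"
  proof (rule ccontr)
    assume "\<not> \<tau> ! i < \<tau> ! j"
    then have ge: "Suc j \<le> \<tau> ! i" using upper j perm by simp
    moreover have "\<tau> ! i \<le> k" using i j perm nth_mem[of i \<tau>] by simp
    ultimately have "\<tau> ! (\<tau> ! i - 1) = \<tau> ! i" using upper[of "\<tau> ! i - 1"] j by simp
    then have "\<tau> ! i - 1 = i"
      using perm i j ge \<open>\<tau> ! i \<le> k\<close> by (subst (asm) nth_eq_iff_index_eq) auto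
    then show False using ge i by simp
  qed
qed

text \<open>The witness is the standardisation of \<sigma>: each letter is replaced by its
  rank.\<close>

lemma U_shape_imp_order_isomorphic:
  assumes dist: "distinct \<sigma>" and shape: "U_shape l \<sigma>"
  shows "\<exists>\<tau>\<in>U_patterns l (length \<sigma>). order_isomorphic \<sigma> \<tau>"
proof
  define rank where "rank x = card {y \<in> set \<sigma>. y \<le> x}" for x
  define \<tau> where "\<tau> = map rank \<sigma>"
  have mono: "rank x < rank y \<longleftrightarrow> x < y" if "x \<in> set \<sigma>" "y \<in> set \<sigma>" for x y
  proof -
    have "rank x < rank y" if "x < y" "y \<in> set \<sigma>" for x y
      unfolding rank_def
    proof (rule psubset_card_mono)
      have "y \<in> {v \<in> set \<sigma>. v \<le> y}" "y \<notin> {v \<in> set \<sigma>. v \<le> x}"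
        using that by simp_all
      moreover have "{v \<in> set \<sigma>. v \<le> x} \<subseteq> {v \<in> set \<sigma>. v \<le> y}" using that by auto
      ultimately show "{v \<in> set \<sigma>. v \<le> x} \<subset> {v \<in> set \<sigma>. v \<le> y}"
        by (metis psubsetI)
    qed simp
    then show ?thesis using that by (metis linorder_neqE_nat order.asym less_irrefl)
  qed
  show "order_isomorphic \<sigma> \<tau>"
    using mono by (simp add: order_isomorphic_def \<tau>_def)
  have inj: "inj_on rank (set \<sigma>)"
    using mono by (metis inj_onI less_irrefl linorder_neqE_nat)
  have "rank ` set \<sigma> = {1..length \<sigma>}"
  proof (rule card_subset_eq)
    show "rank ` set \<sigma> \<subseteq> {1..length \<sigma>}"
    proof
      fix r assume "r \<in> rank ` set \<sigma>"
      then obtain x where x: "x \<in> set \<sigma>" "r = rank x" by blast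
      have "card {x} \<le> rank x" unfolding rank_def using x by (intro card_mono) auto
      moreover have "rank x \<le> card (set \<sigma>)" unfolding rank_def by (intro card_mono) auto
      ultimately show "r \<in> {1..length \<sigma>}" using x dist by (simp add: distinct_card)
    qed
    show "card (rank ` set \<sigma>) = card {1..length \<sigma>}"
      using inj dist by (simp add: card_image distinct_card)
  qed simp
  then have perm: "\<tau> \<in> perms (length \<sigma>)"
    using inj dist by (intro permutations_of_setI) (simp_all add: \<tau>_def distinct_map)
  have "\<tau> ! j = Suc j" if j: "l \<le> j" "j < length \<sigma>" for j
  proof -
    \<comment> \<open>From index \<open>l\<close> on, a letter exceeds everything before it and is
      below everything after it, so its rank is its index plus one.\<close>
    have "{y \<in> set \<sigma>. y \<le> \<sigma> ! j} = (!) \<sigma> ` {..j}"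
    proof (intro equalityI subsetI)
      fix y assume "y \<in> {y \<in> set \<sigma>. y \<le> \<sigma> ! j}"
      then obtain i where i: "i < length \<sigma>" "y = \<sigma> ! i" "\<sigma> ! i \<le> \<sigma> ! j"
        by (auto simp: in_set_conv_nth)
      have "\<not> j < i" using shape i j unfolding U_shape_def by (meson leD le_trans less_imp_le)
      then show "y \<in> (!) \<sigma> ` {..j}" using i by auto
    next
      fix y assume "y \<in> (!) \<sigma> ` {..j}"
      then obtain i where "i \<le> j" "y = \<sigma> ! i" by auto
      then show "y \<in> {y \<in> set \<sigma>. y \<le> \<sigma> ! j}"
        using shape j unfolding U_shape_def by (cases "i = j") (auto simp: le_less)
    qed
    moreover have "inj_on ((!) \<sigma>) {..j}"
      using dist j by (auto intro: inj_on_nth)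
    ultimately show ?thesis
      using j by (simp add: \<tau>_def rank_def card_image)
  qed
  then have "drop l \<tau> = [l + 1..<length \<sigma> + 1]"
    by (intro nth_equalityI) (auto simp: \<tau>_def simp del: upt_Suc)
  with perm show "\<tau> \<in> U_patterns l (length \<sigma>)"
    by (simp add: U_patterns_def)
qed

section \<open>Avoiding all patterns of \<open>U_patterns l k\<close> at once\<close>

definition U_free :: "nat \<Rightarrow> nat \<Rightarrow> nat list \<Rightarrow> bool" where
  "U_free l k \<rho> \<longleftrightarrow> (\<nexists>\<sigma>. subseq \<sigma> \<rho> \<and> length \<sigma> = k \<and> U_shape l \<sigma>)"

text \<open>Occurrences inherit the shape from their pattern. Conversely, a subsequence of that
  shape has distinct letters and so standardises to some pattern of the set.\<close>

lemma avoids_U_patterns_iff: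
  assumes "distinct \<rho>"
  shows "(\<forall>\<tau>\<in>U_patterns l k. avoids \<rho> \<tau>) \<longleftrightarrow> U_free l k \<rho>"
proof
  assume av: "\<forall>\<tau>\<in>U_patterns l k. avoids \<rho> \<tau>"
  show "U_free l k \<rho>"
    unfolding U_free_def
  proof clarify
    fix \<sigma> assume \<sigma>: "subseq \<sigma> \<rho>" "k = length \<sigma>" "U_shape l \<sigma>"
    have "distinct \<sigma>" using \<sigma>(1) assms by (auto simp: subseq_conv_nths)
    then show False
      using U_shape_imp_order_isomorphic \<sigma> av unfolding contains_pattern_def by blast
  qed
next
  assume free: "U_free l k \<rho>"
  show "\<forall>\<tau>\<in>U_patterns l k. avoids \<rho> \<tau>"
  proof clarify
    fix \<tau> assume \<tau>: "\<tau> \<in> U_patterns l k" "contains_pattern \<rho> \<tau>"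
    then obtain \<sigma> where \<sigma>: "subseq \<sigma> \<rho>" "order_isomorphic \<sigma> \<tau>"
      by (auto simp: contains_pattern_def)
    have "length \<tau> = k"
      using \<tau>(1) by (auto simp: U_patterns_def dest: length_finite_permutations_of_set)
    then show False
      using free \<sigma> U_shape_order_isomorphic U_shape_U_patterns[OF \<tau>(1)]
      unfolding U_free_def order_isomorphic_def by metis
  qed
qed

lemma U_free_map_iff:
  assumes "strict_mono f"
  shows "U_free l k (map f xs) \<longleftrightarrow> U_free l k xs"
proof -
  have "U_shape l (map f \<sigma>) \<longleftrightarrow> U_shape l \<sigma>" for \<sigma>
    using strict_mono_less[OF assms] by (auto simp: U_shape_def)
  then show ?thesis
    unfolding U_free_def subseq_conv_nths nths_map by (metis length_map)
qed

text \<open>A word of length \<open>l\<close> has no index from \<open>l\<close> on, so the shape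
  condition is void and any \<open>l\<close> letters form an occurrence.\<close>

lemma U_free_diag: "U_free l l \<rho> \<longleftrightarrow> length \<rho> < l"
proof -
  have "U_shape l (take l \<rho>)" by (simp add: U_shape_def)
  moreover have "subseq (take l \<rho>) \<rho>"
    by (metis append_take_drop_id list_emb_append2 subseq_order.order_refl subseq_rev_drop_many)
  ultimately show ?thesis
    unfolding U_free_def
    by (metis U_shape_def leD length_take list_emb_length min.absorb2 not_le order.refl)
qed

text \<open>As \<open>l \<le> k\<close>, the last of \<open>Suc k\<close> letters must be the
  maximum. \<open>M\<close> extends any occurrence of length \<open>k\<close> in \<alpha>.
  Conversely, an occurrence ending in \<beta> uses no letter of \<alpha>, since those are larger;
  any other has all but its last letter in \<alpha>.\<close>

lemma U_free_append_Cons_iff: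
  assumes lt: "\<And>x. x \<in> set \<alpha> \<union> set \<beta> \<Longrightarrow> x < M"
    and gt: "\<And>a b. a \<in> set \<alpha> \<Longrightarrow> b \<in> set \<beta> \<Longrightarrow> b < a"
    and "l \<le> k"
  shows "U_free l (Suc k) (\<alpha> @ M # \<beta>) \<longleftrightarrow> U_free l k \<alpha> \<and> U_free l (Suc k) \<beta>"
proof
  assume free: "U_free l (Suc k) (\<alpha> @ M # \<beta>)"
  show "U_free l k \<alpha> \<and> U_free l (Suc k) \<beta>"
  proof
    show "U_free l k \<alpha>"
      unfolding U_free_def
    proof clarify
      fix \<sigma> assume \<sigma>: "subseq \<sigma> \<alpha>" "k = length \<sigma>" "U_shape l \<sigma>"
      have "set \<sigma> \<subseteq> set \<alpha>" using \<sigma>(1) by (auto dest: set_mono_subseq)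
      then have "U_shape l (\<sigma> @ [M])" using \<sigma>(3) lt by (auto simp: U_shape_snoc)
      moreover have "subseq (\<sigma> @ [M]) (\<alpha> @ M # \<beta>)"
        using \<sigma>(1) by (intro list_emb_append_mono) auto
      ultimately show False using free \<sigma>(2) unfolding U_free_def by (metis length_append_singleton)
    qed
    have "subseq \<sigma> (\<alpha> @ M # \<beta>)" if "subseq \<sigma> \<beta>" for \<sigma>
      using that by (meson subseq_drop_many list_emb_Cons)
    then show "U_free l (Suc k) \<beta>" using free unfolding U_free_def by blast
  qed
next
  assume free: "U_free l k \<alpha> \<and> U_free l (Suc k) \<beta>"
  show "U_free l (Suc k) (\<alpha> @ M # \<beta>)"
    unfolding U_free_def
  proof clarify
    fix \<sigma> assume \<sigma>: "subseq \<sigma> (\<alpha> @ M # \<beta>)" "length \<sigma> = Suc k" "U_shape l \<sigma>"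
    then obtain \<sigma>' z where \<sigma>': "\<sigma> = \<sigma>' @ [z]" "length \<sigma>' = k"
      by (metis length_Suc_conv_rev)
    have shape: "U_shape l \<sigma>'" and max: "\<And>y. y \<in> set \<sigma>' \<Longrightarrow> y < z"
      using \<sigma>(3) \<sigma>' assms(3) by (auto simp: U_shape_snoc)
    obtain s t where st: "\<sigma> = s @ t" "subseq s \<alpha>" "subseq t (M # \<beta>)"
      using \<sigma>(1) by (auto elim: subseq_appendE)
    show False
    \<comment> \<open>The first case says that at most the last letter \<open>z\<close> lies outside
      \<alpha>.\<close>
    proof (cases "\<sigma>' = s \<or> t = []")
      case True
      then have "subseq \<sigma>' \<alpha>"
        using st \<sigma>' by (auto intro: subseq_order.trans[of \<sigma>' "\<sigma>' @ [z]"])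
      then show False using free shape \<sigma>' unfolding U_free_def by blast
    next
      case False
      then obtain t' where t': "t = t' @ [z]" "\<sigma>' = s @ t'"
        using st(1) \<sigma>'(1) by (cases t rule: rev_cases) auto
      \<comment> \<open>Two letters \<open>u\<close> and \<open>z\<close> now come from
        \<open>M # \<beta>\<close>; since \<open>u < z\<close>, the first is not \<open>M\<close>,
        and all of \<open>t\<close> lies in \<beta>.\<close>
      then obtain u us where t'_eq: "t' = u # us"
        using False by (cases t') auto
      have "set t \<subseteq> insert M (set \<beta>)" using st(3) by (auto dest!: set_mono_subseq)
      then have "u \<in> insert M (set \<beta>)" "z \<in> insert M (set \<beta>)" by (auto simp: t' t'_eq)
      moreover have "u < z" using max by (simp add: t' t'_eq)
      ultimately have "u \<noteq> M" using lt by fastforce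
      then have t\<beta>: "subseq t \<beta>" using st(3) by (auto simp: t' t'_eq split: if_splits)
      then have z: "z \<in> set \<beta>" by (auto simp: t' dest!: set_mono_subseq)
      have "s = []"
      proof (rule ccontr)
        assume "s \<noteq> []"
        then obtain a where "a \<in> set s" by (cases s) auto
        then have "a \<in> set \<alpha>" "a < z" using st(2) max t' by (auto dest!: set_mono_subseq)
        then show False using gt z by fastforce
      qed
      then show False using free t\<beta> st \<sigma> unfolding U_free_def by auto
    qed
  qed
qed

section \<open>The base polynomial and the continued fraction\<close>

lemma gf_U_free_diag:
  assumes "l \<ge> 1"
  shows "gf (U_free l l) = (\<Sum>j=0..l - 1. fps_const (catalan j) * fps_X ^ j)"
proof (rule fps_ext)
  fix n
  have "avoiders (U_free l l) n = (if n < l then avoiders (\<lambda>_. True) n else {})"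
    by (auto simp: avoiders_def U_free_diag length_finite_permutations_of_set)
  then have "gf (U_free l l) $ n = (if n < l then catalan n else 0)"
    by (simp add: gf_def card_132_avoiders)
  \<comment> \<open>Because \<open>l \<ge> 1\<close>, the index range ends exactly where
    \<open>n < l\<close> fails.\<close>
  also have "\<dots> = (\<Sum>j=0..l - 1. if j = n then catalan j else 0)"
    using assms by (auto simp: sum.delta)
  also have "\<dots> = (\<Sum>j=0..l - 1. fps_const (catalan j) * fps_X ^ j) $ n"
    unfolding fps_sum_nth by (intro sum.cong) auto
  finally show "gf (U_free l l) $ n = (\<Sum>j=0..l - 1. fps_const (catalan j) * fps_X ^ j) $ n" .
qed

text \<open>The left part is governed by \<open>k\<close> and only the right part by
  \<open>Suc k\<close>, so the recurrence is linear in the new series and is solved by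
  division.\<close>

lemma gf_U_free_Suc:
  assumes "l \<le> k"
  shows "gf (U_free l (Suc k)) = 1 / (1 - fps_X * gf (U_free l k))"
proof -
  have "gf (U_free l (Suc k)) = 1 + fps_X * (gf (U_free l (Suc k)) * gf (U_free l k))"
  proof (rule gf_recurrence)
    show "U_free l (Suc k) []" by (auto simp: U_free_def)
    fix n j \<alpha> \<beta> assume h: "j \<le> n" "\<alpha> \<in> perms (n - j)" "\<beta> \<in> perms j"
    have "set \<alpha> = {1..n - j}" "set \<beta> = {1..j}"
      using h by (auto dest: permutations_of_setD)
    moreover have "strict_mono ((+) j)" by (simp add: strict_mono_def)
    ultimately show "U_free l (Suc k) (map ((+) j) \<alpha> @ Suc n # \<beta>) \<longleftrightarrow>
        U_free l k \<alpha> \<and> U_free l (Suc k) \<beta>"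
      using h(1) assms by (subst U_free_append_Cons_iff) (auto simp: U_free_map_iff)
  qed
  then have "gf (U_free l (Suc k)) * (1 - fps_X * gf (U_free l k)) = 1"
    by (simp add: algebra_simps)
  moreover from this have "1 - fps_X * gf (U_free l k) \<noteq> 0" by force
  ultimately show ?thesis by (metis nonzero_mult_div_cancel_right)
qed

theorem corollary2:
  fixes k l :: nat
  assumes "k \<ge> l" and "l \<ge> 1"
  shows "avoiders_gf (U_patterns l k) =
           cont_frac (k - l) (\<Sum>j=0..l - 1. fps_const (catalan j) * fps_X ^ j)"
proof -
  have "avoiders_gf (U_patterns l k) = gf (U_free l k)"
    unfolding avoiders_gf_def gf_def avoiders_def
    by (intro arg_cong[where f = Abs_fps] ext arg_cong[where f = of_nat] arg_cong[where f = card])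
      (use avoids_U_patterns_iff in \<open>auto dest: permutations_of_setD\<close>)
  \<comment> \<open>Induction on \<open>k\<close> from the diagonal \<open>k = l\<close>; each
    increment of \<open>k\<close> adds one step to the fraction.\<close>
  also have "\<dots> = cont_frac (k - l) (\<Sum>j=0..l - 1. fps_const (catalan j) * fps_X ^ j)"
    using assms(1)
  proof (induction k rule: dec_induct)
    case base
    show ?case using gf_U_free_diag[OF assms(2)] by simp
  next
    case (step k)
    then show ?case by (simp add: Suc_diff_le gf_U_free_Suc)
  qed
  finally show ?thesis .
qed

end
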